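(* The difference $\mathrm{gp}_{\rm d}(G)-\mathrm{gp}_{\rm d}(G-e)$ can be arbitrarily large: for every positive integer $N$ there exist a connected graph $G$ and an edge $e$ of $G$ such that $\mathrm{gp}_{\rm d}(G)-\mathrm{gp}_{\rm d}(G-e)\ge N$.
   Context: All graphs are finite, simple and connected. For a graph $G$ and $Z\subseteq V(G)$, two vertices $p,q\in V(G)$ are $Z$-positionable if no shortest $p,q$-path in $G$ has an internal vertex in $Z$. $Z$ is a dual general position set if every two vertices of $Z$ are $Z$-positionable and every two vertices of $V(G)\setminus Z$ are $Z$-positionable (the empty set qualifies). $\mathrm{gp}_{\rm d}(G)$ is the maximum cardinality of a dual general position set of $G$. $G-e$ is the graph obtained by deleting the edge $e$. *)

theory Defs
  imports Graph_Theory.Pair_Digraph Graph_Theory.Vertex_Walk Graph_Theory.Digraph_Component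
begin

text \<open>
  A finite simple graph is a \<^locale>\<open>pair_graph\<close>, i.e. a finite symmetric loop-free digraph
  without parallel arcs. An undirected edge \<open>uv\<close> is the pair of arcs \<open>(u,v)\<close>, \<open>(v,u)\<close>.
\<close>

definition shortest_vpath :: "'a pair_pre_digraph \<Rightarrow> 'a \<Rightarrow> 'a vwalk \<Rightarrow> 'a \<Rightarrow> bool" where
  "shortest_vpath G p xs q \<longleftrightarrow>
     vpath xs (with_proj G) \<and> hd xs = p \<and> last xs = q \<and>
     (\<forall>ys. vpath ys (with_proj G) \<and> hd ys = p \<and> last ys = q \<longrightarrow> vwalk_length xs \<le> vwalk_length ys)"

definition internal_verts :: "'a vwalk \<Rightarrow> 'a set" where
  "internal_verts xs = set (butlast (tl xs))"

definition positionable :: "'a pair_pre_digraph \<Rightarrow> 'a set \<Rightarrow> 'a \<Rightarrow> 'a \<Rightarrow> bool" where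
  "positionable G Z p q \<longleftrightarrow> \<not> (\<exists>xs. shortest_vpath G p xs q \<and> internal_verts xs \<inter> Z \<noteq> {})"

definition dual_general_position :: "'a pair_pre_digraph \<Rightarrow> 'a set \<Rightarrow> bool" where
  "dual_general_position G Z \<longleftrightarrow>
     Z \<subseteq> pverts G \<and>
     pairwise (positionable G Z) Z \<and>
     pairwise (positionable G Z) (pverts G - Z)"

definition gp_d :: "'a pair_pre_digraph \<Rightarrow> nat" where
  "gp_d G = Max (card ` {Z. dual_general_position G Z})"

text \<open>Deleting an edge keeps all vertices and removes the arcs in both directions.\<close>

definition del_edge :: "'a pair_pre_digraph \<Rightarrow> 'a \<times> 'a \<Rightarrow> 'a pair_pre_digraph" where
  "del_edge G e = G\<lparr>parcs := parcs G - {e, prod.swap e}\<rparr>"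

end

theory Submission
  imports Defs
begin

text \<open>
  Join two adjacent spine vertices to \<open>n \<ge> 3\<close> pairwise nonadjacent pages. Every page is simplicial,
  so it is never internal to a shortest path, and the pages form a dual general position set of
  size \<open>n\<close>. Deleting the spine edge leaves \<open>K\<^bsub>2,n\<^esub>\<close>. There the complement of a dual general
  position set is geodesically convex, so once it contains both spine vertices or two pages it
  contains everything. Otherwise the set itself contains a spine vertex and two pages, and that
  spine vertex lies between them. Hence only the empty set is in dual general position.
\<close>

text \<open>Finiteness is what gives the \<open>Max\<close> in \<open>gp_d\<close> its
  meaning.\<close>

lemma finite_dual_general_position:
  assumes "finite (pverts G)"
  shows "finite {Z. dual_general_position G Z}"
  by (rule finite_subset[of _ "Pow (pverts G)"]) (auto simp: dual_general_position_def assms)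

lemma card_le_gp_d:
  assumes "finite (pverts G)" "dual_general_position G Z"
  shows "card Z \<le> gp_d G"
  unfolding gp_d_def using assms finite_dual_general_position[of G] by (intro Max_ge) auto

lemma dual_general_position_empty: "dual_general_position G {}"
  by (simp add: dual_general_position_def pairwise_def positionable_def)

lemma internal_vertsE:
  assumes "w \<in> internal_verts xs"
  obtains as a b bs where "xs = as @ a # w # b # bs"
proof -
  obtain x ys where xs: "xs = x # ys" and w: "w \<in> set (butlast ys)"
    using assms by (cases xs) (auto simp: internal_verts_def)
  then obtain us vs where "butlast ys = us @ w # vs"
    by (auto dest: split_list)
  with w have "ys = us @ w # vs @ [last ys]"
    by (metis append_Cons append_assoc append_butlast_last_id butlast.simps(1) list.distinct(1)
        append_is_Nil_conv)
  moreover obtain as a where "x # us = as @ [a]"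
    by (metis list.distinct(1) rev_exhaust)
  moreover obtain b bs where "vs @ [last ys] = b # bs"
    by (cases "vs @ [last ys]") auto
  ultimately have "xs = as @ a # w # b # bs"
    using xs by (metis append.assoc append_Cons append_Nil)
  then show thesis by (rule that)
qed

text \<open>Cutting a walk at a shared vertex lets its tail be rerouted while the arcs before the
  cut stay the same.\<close>

lemma set_vwalk_arcs_append_Cons:
  "set (vwalk_arcs (xs @ y # ys)) = set (vwalk_arcs (xs @ [y])) \<union> set (vwalk_arcs (y # ys))"
  by (induction xs rule: vwalk_arcs.induct) auto

text \<open>If the neighbours of \<open>w\<close> on the path were adjacent, skipping
  \<open>w\<close> would give a shorter path with the same ends.\<close>

lemma internal_vert_neighbours:
  assumes "shortest_vpath G p xs q" "w \<in> internal_verts xs"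
  obtains a b where "(a, w) \<in> parcs G" "(w, b) \<in> parcs G" "a \<noteq> b" "(a, b) \<notin> parcs G"
proof -
  obtain as a b bs where xs: "xs = as @ a # w # b # bs"
    using assms(2) by (rule internal_vertsE)
  let ?ys = "as @ a # b # bs"
  have path: "vpath xs (with_proj G)" and ends: "hd xs = p" "last xs = q"
    and short: "\<And>ys. vpath ys (with_proj G) \<Longrightarrow> hd ys = p \<Longrightarrow> last ys = q \<Longrightarrow>
      vwalk_length xs \<le> vwalk_length ys"
    using assms(1) by (auto simp: shortest_vpath_def)
  have "(a, w) \<in> parcs G" "(w, b) \<in> parcs G" "a \<noteq> b"
    using path unfolding xs vpath_def vwalk_def
    by (auto simp: set_vwalk_arcs_append_Cons[of as a "w # b # bs"])
  moreover have "(a, b) \<notin> parcs G"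
  proof
    assume "(a, b) \<in> parcs G"
    then have "vpath ?ys (with_proj G)"
      using path unfolding xs vpath_def vwalk_def
      by (auto simp: set_vwalk_arcs_append_Cons[of as a "w # b # bs"]
          set_vwalk_arcs_append_Cons[of as a "b # bs"])
    moreover have "hd ?ys = p" "last ?ys = q"
      using ends by (auto simp: xs hd_append)
    ultimately show False
      using short[of ?ys] by (simp add: xs)
  qed
  ultimately show thesis by (rule that)
qed

text \<open>The second assumption makes every vertex of \<open>Z\<close> simplicial, which
  \<open>internal_vert_neighbours\<close> forbids for internal vertices. So \<open>Z\<close> blocks
  no pair at all.\<close>

lemma dual_general_position_simplicial:
  assumes "Z \<subseteq> pverts G"
    and "\<And>w a b. w \<in> Z \<Longrightarrow> (a, w) \<in> parcs G \<Longrightarrow> (w, b) \<in> parcs G \<Longrightarrow> a \<noteq> b \<Longrightarrow> (a, b) \<in> parcs G"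
  shows "dual_general_position G Z"
proof -
  have "positionable G Z p q" for p q
    unfolding positionable_def using assms(2)
    by (metis disjoint_iff internal_vert_neighbours)
  then show ?thesis
    using assms(1) by (auto simp: dual_general_position_def pairwise_def)
qed

lemma not_positionable_common_neighbour:
  assumes "pair_wf_digraph G" "p \<noteq> q" "(p, q) \<notin> parcs G"
    and "(p, w) \<in> parcs G" "(w, q) \<in> parcs G" "w \<in> Z"
  shows "\<not> positionable G Z p q"
proof -
  interpret pair_wf_digraph G by fact
  have "p \<noteq> w" "w \<noteq> q" using assms by auto
  then have "vpath [p, w, q] (with_proj G)"
    using assms by (auto simp: vpath_def vwalk_def dest: in_arcsD1 in_arcsD2)
  moreover have "2 \<le> vwalk_length ys"
    if "vpath ys (with_proj G)" "hd ys = p" "last ys = q" for ys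
    \<comment> \<open>A single vertex contradicts \<open>p \<noteq> q\<close>, and a single arc
      contradicts nonadjacency.\<close>
    using that assms(2,3)
    by (cases ys rule: vwalk_arcs.cases)
      (auto simp: vpath_def vwalk_def neq_Nil_conv Suc_le_eq split: if_splits)
  ultimately have "shortest_vpath G p [p, w, q] q"
    by (auto simp: shortest_vpath_def numeral_2_eq_2)
  then show ?thesis
    using assms(6) by (auto simp: positionable_def internal_verts_def)
qed

lemma connected_if_common_neighbour:
  assumes "pair_wf_digraph G" "pverts G \<noteq> {}"
    and "\<And>u v. u \<in> pverts G \<Longrightarrow> v \<in> pverts G \<Longrightarrow> u \<noteq> v \<Longrightarrow>
      (u, v) \<in> parcs G \<or> (\<exists>w. (u, w) \<in> parcs G \<and> (w, v) \<in> parcs G)"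
  shows "Digraph_Component.connected (with_proj G)"
proof -
  interpret pair_wf_digraph G by fact
  have "u \<rightarrow>\<^sup>*\<^bsub>with_proj G\<^esub> v" if "u \<in> pverts G" "v \<in> pverts G" for u v
    using assms(3)[OF that] that
    by (cases "u = v") (auto intro: reachable_adjI reachable_trans)
  \<comment> \<open>\<open>connected\<close> refers to the symmetric closure, to which reachability
    carries over.\<close>
  then show ?thesis
    unfolding Digraph_Component.connected_def
    using assms(2) by (intro strongly_connectedI) (auto intro: reachable_mk_symmetricI)
qed

text \<open>The spine is 0 and 1, the pages are 2 to \<open>n + 1\<close>.\<close>

definition book_graph :: "nat \<Rightarrow> nat pair_pre_digraph" where
  "book_graph n = \<lparr>pverts = {..<n + 2},
     parcs = {(u, v). u < n + 2 \<and> v < n + 2 \<and> u \<noteq> v \<and> (u < 2 \<or> v < 2)}\<rparr>"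

lemma pverts_book_graph [simp]: "pverts (book_graph n) = {..<n + 2}"
  by (simp add: book_graph_def)

lemma parcs_book_graph [simp]:
  "(u, v) \<in> parcs (book_graph n) \<longleftrightarrow> u < n + 2 \<and> v < n + 2 \<and> u \<noteq> v \<and> (u < 2 \<or> v < 2)"
  by (simp add: book_graph_def)

lemma pverts_del_edge [simp]: "pverts (del_edge G e) = pverts G"
  by (simp add: del_edge_def)

text \<open>Only arcs between spine and pages survive. The edge is written with
  \<open>Suc 0\<close>, the simplifier's normal form of 1.\<close>

lemma parcs_del_spine [simp]:
  "(u, v) \<in> parcs (del_edge (book_graph n) (0, Suc 0)) \<longleftrightarrow>
     u < n + 2 \<and> v < n + 2 \<and> (u < 2) \<noteq> (v < 2)"
  by (auto simp: del_edge_def)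

lemma pair_graph_book_graph: "pair_graph (book_graph n)"
proof
  show "finite (parcs (book_graph n))"
    by (rule finite_subset[of _ "{..<n + 2} \<times> {..<n + 2}"]) auto
qed (auto simp: symmetric_def sym_def)

lemma pair_wf_digraph_del_spine: "pair_wf_digraph (del_edge (book_graph n) (0, 1))"
  by unfold_locales auto

lemma connected_book_graph: "Digraph_Component.connected (with_proj (book_graph n))"
proof (rule connected_if_common_neighbour)
  show "pair_wf_digraph (book_graph n)" by unfold_locales auto
  fix u v assume "u \<in> pverts (book_graph n)" "v \<in> pverts (book_graph n)" "u \<noteq> v"
  then show "(u, v) \<in> parcs (book_graph n) \<or>
      (\<exists>w. (u, w) \<in> parcs (book_graph n) \<and> (w, v) \<in> parcs (book_graph n))"
    \<comment> \<open>Two pages have the spine vertex 0 in common.\<close>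
    by (cases "u < 2 \<or> v < 2") (auto intro!: exI[of _ 0])
qed (auto simp: lessThan_empty_iff)

lemma connected_del_spine:
  assumes "n \<ge> 1"
  shows "Digraph_Component.connected (with_proj (del_edge (book_graph n) (0, 1)))"
    (is "Digraph_Component.connected (with_proj ?H)")
proof (rule connected_if_common_neighbour)
  fix u v assume "u \<in> pverts ?H" "v \<in> pverts ?H"
  then show "(u, v) \<in> parcs ?H \<or> (\<exists>w. (u, w) \<in> parcs ?H \<and> (w, v) \<in> parcs ?H)"
    \<comment> \<open>Pages meet at 0; spine vertices meet at page 2, which exists since
      \<open>n \<ge> 1\<close>.\<close>
    using assms by (cases "u < 2") (auto intro: exI[of _ 0] exI[of _ 2])
qed (simp_all only: pair_wf_digraph_del_spine, simp add: lessThan_empty_iff)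

lemma gp_d_book_graph: "n \<le> gp_d (book_graph n)"
proof -
  have "dual_general_position (book_graph n) {2..<n + 2}"
    by (rule dual_general_position_simplicial) auto
  from card_le_gp_d[OF _ this] show ?thesis by simp
qed

lemma gp_d_del_spine:
  assumes "n \<ge> 3"
  shows "gp_d (del_edge (book_graph n) (0, 1)) = 0"
proof -
  let ?H = "del_edge (book_graph n) (0, 1)"
  \<comment> \<open>Two vertices on one side of the bipartition have every vertex of the other side
    as a common neighbour.\<close>
  have btw: "\<not> positionable ?H A p q"
    if "p \<noteq> q" "p < n + 2" "q < n + 2" "w < n + 2" "w \<in> A"
      "(p < 2) = (q < 2)" "(w < 2) \<noteq> (p < 2)" for A p q w
    using that by (intro not_positionable_common_neighbour pair_wf_digraph_del_spine) auto
  have "Z = {}" if "dual_general_position ?H Z" for Z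
  proof -
    have sub: "Z \<subseteq> {..<n + 2}"
      using that by (simp add: dual_general_position_def)
    have inside: "positionable ?H Z p q"
      if "p \<in> Z" "q \<in> Z" "p \<noteq> q" for p q
      using that \<open>dual_general_position ?H Z\<close>
      by (auto simp: dual_general_position_def pairwise_def)
    have outside: "positionable ?H Z p q"
      if "p < n + 2" "q < n + 2" "p \<notin> Z" "q \<notin> Z" "p \<noteq> q" for p q
      using that \<open>dual_general_position ?H Z\<close>
      by (auto simp: dual_general_position_def pairwise_def)
    show "Z = {}"
    proof (cases "Z \<inter> {..<2} = {}")
      case True
      then have "0 \<notin> Z" "1 \<notin> Z" by auto
      \<comment> \<open>Both spine vertices lie outside \<open>Z\<close>, so a page in
        \<open>Z\<close> would lie between them.\<close>
      then have "positionable ?H Z 0 1" by (intro outside) auto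
      then have "w \<notin> Z" if "\<not> w < 2" "w < n + 2" for w
        using btw[of 0 1 w Z] that by auto
      then show ?thesis
        using True sub by blast
    next
      case False
      then obtain a where a: "a \<in> Z" "a < 2" by auto
      \<comment> \<open>The vertex \<open>a\<close> of \<open>Z\<close> lies between any two pages,
        so exactly one of them belongs to \<open>Z\<close>.\<close>
      have "p \<in> Z \<longleftrightarrow> q \<notin> Z"
        if "2 \<le> p" "2 \<le> q" "p < n + 2" "q < n + 2" "p \<noteq> q" for p q
      proof -
        have "\<not> positionable ?H Z p q"
          using that a by (intro btw[where w = a]) simp_all
        then show ?thesis
          using inside[of p q] outside[of p q] that(3-5) by blast
      qed
      \<comment> \<open>Pigeonhole: among three pages, two agree on membership in \<open>Z\<close>.
        Page 4 exists because \<open>n \<ge> 3\<close>.\<close>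
      from this[of 2 3] this[of 2 4] this[of 3 4] assms show ?thesis by simp
    qed
  qed
  then have "{Z. dual_general_position ?H Z} = {{}}"
    using dual_general_position_empty by auto
  then show ?thesis by (simp add: gp_d_def)
qed

theorem theorem4p3:
  fixes N :: nat
  assumes "N > 0"
  shows "\<exists>(G :: nat pair_pre_digraph) e.
           pair_graph G \<and> Digraph_Component.connected (with_proj G) \<and>
           e \<in> parcs G \<and> Digraph_Component.connected (with_proj (del_edge G e)) \<and>
           int (gp_d G) - int (gp_d (del_edge G e)) \<ge> int N"
proof (intro exI conjI)
  \<comment> \<open>With \<open>N > 0\<close>, the summand 2 guarantees the three pages that
    \<open>gp_d_del_spine\<close> requires.\<close>
  let ?G = "book_graph (N + 2)"
  show "pair_graph ?G" by (rule pair_graph_book_graph)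
  show "Digraph_Component.connected (with_proj ?G)" by (rule connected_book_graph)
  show "(0, 1) \<in> parcs ?G" by simp
  show "Digraph_Component.connected (with_proj (del_edge ?G (0, 1)))"
    by (rule connected_del_spine) simp
  show "int (gp_d ?G) - int (gp_d (del_edge ?G (0, 1))) \<ge> int N"
    using gp_d_book_graph[of "N + 2"] gp_d_del_spine[of "N + 2"] assms by simp
qed

end
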